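(* Let $Z=(U,\Omega,r)$ be a multimatroid and let $\prec$ be a total ordering of its skew classes. Then \[Q(Z;\mathbf x,t)= \sum_{T\in \mathrm{Comp}(Z,\prec)} \Bigg(\prod_{\omega \in \mathrm{inact}_{\prec}(T)} \mathbf x_{T_{\omega}}\Bigg) \Bigg(\prod_{\omega \in \mathrm{act}_{\prec}(T)} \Bigg(\sum_{e \in \omega-\{T_{\omega}\}} \mathbf x_e + t\,\mathbf x_{T_{\omega}}\Bigg)\Bigg).\]
   Context: A carrier is a pair $(U,\Omega)$, $U$ finite, $\Omega$ a partition of $U$ into non-empty skew classes; subtransversals meet each skew class at most once, transversals exactly once; skew pair: two distinct elements of a skew class. A multimatroid $Z=(U,\Omega,r)$ has a non-negative integer $r$ on subtransversals with (R1) on each transversal $r$ is a matroid rank function; (R2) for subtransversal $S$ and skew pair $\{x,y\}$ in a skew class disjoint from $S$, $r(S\cup\{x\})+r(S\cup\{y\})-2r(S)\ge1$. $n(S)=|S|-r(S)$; circuits are minimal subtransversals with $n>0$. $S_\omega$ is the element of $S\cap\omega$. A total order $\prec$ on skew classes induces an order on any subtransversal; $\min(C)$ is the least element. For a transversal $T$, a skew class $\omega$ is active with respect to $T$ if there is a circuit $C$ with $\min(C)\in\omega$ and $C-\omega\subseteq T$; otherwise inactive. $\mathrm{act}_\prec(T)$, $\mathrm{inact}_\prec(T)$ denote these sets. A transversal $S$ is $(Z,\prec)$-cocompatible if there is no circuit $C$ of $Z$ with $C-S=\{\min(C)\}$; $\mathrm{Comp}(Z,\prec)$ is the set of such transversals.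 $Q(Z;\mathbf x,t)=\sum_T t^{n(T)}\prod_{u\in T}\mathbf x_u$ over all transversals $T$, with indeterminates $\mathbf x_u$, $u\in U$. *)

theory Defs
  imports Main "HOL-Library.Disjoint_Sets" "HOL-Library.Poly_Mapping"
begin

section \<open>Multimatroids\<close>

definition is_carrier :: "'a set \<Rightarrow> 'a set set \<Rightarrow> bool" where
  "is_carrier U \<Omega> \<longleftrightarrow> finite U \<and> partition_on U \<Omega>"

definition subtransversal :: "'a set \<Rightarrow> 'a set set \<Rightarrow> 'a set \<Rightarrow> bool" where
  "subtransversal U \<Omega> S \<longleftrightarrow> S \<subseteq> U \<and> (\<forall>\<omega>\<in>\<Omega>. card (S \<inter> \<omega>) \<le> 1)"

definition transversal :: "'a set \<Rightarrow> 'a set set \<Rightarrow> 'a set \<Rightarrow> bool" where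
  "transversal U \<Omega> T \<longleftrightarrow> T \<subseteq> U \<and> (\<forall>\<omega>\<in>\<Omega>. card (T \<inter> \<omega>) = 1)"

definition matroid_rank_function :: "'a set \<Rightarrow> ('a set \<Rightarrow> nat) \<Rightarrow> bool" where
  "matroid_rank_function E r \<longleftrightarrow>
     (\<forall>A. A \<subseteq> E \<longrightarrow> r A \<le> card A) \<and>
     (\<forall>A B. A \<subseteq> B \<longrightarrow> B \<subseteq> E \<longrightarrow> r A \<le> r B) \<and>
     (\<forall>A B. A \<subseteq> E \<longrightarrow> B \<subseteq> E \<longrightarrow> r (A \<union> B) + r (A \<inter> B) \<le> r A + r B)"

text \<open>The rank function is only meaningful on subtransversals; its values on other sets are
  unconstrained and never used.\<close>

definition multimatroid :: "'a set \<Rightarrow> 'a set set \<Rightarrow> ('a set \<Rightarrow> nat) \<Rightarrow> bool" where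
  "multimatroid U \<Omega> r \<longleftrightarrow>
     is_carrier U \<Omega> \<and>
     (\<forall>T. transversal U \<Omega> T \<longrightarrow> matroid_rank_function T r) \<and>
     (\<forall>S \<omega> x y. subtransversal U \<Omega> S \<longrightarrow> \<omega> \<in> \<Omega> \<longrightarrow> \<omega> \<inter> S = {} \<longrightarrow>
        x \<in> \<omega> \<longrightarrow> y \<in> \<omega> \<longrightarrow> x \<noteq> y \<longrightarrow>
        int (r (S \<union> {x})) + int (r (S \<union> {y})) - 2 * int (r S) \<ge> 1)"

text \<open>No truncation occurs in the following subtraction for subtransversals of a multimatroid.\<close>

definition nullity :: "('a set \<Rightarrow> nat) \<Rightarrow> 'a set \<Rightarrow> nat" where
  "nullity r S = card S - r S"

definition circuit :: "'a set \<Rightarrow> 'a set set \<Rightarrow> ('a set \<Rightarrow> nat) \<Rightarrow> 'a set \<Rightarrow> bool" where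
  "circuit U \<Omega> r C \<longleftrightarrow> subtransversal U \<Omega> C \<and> nullity r C > 0 \<and>
     (\<forall>D. D \<subset> C \<longrightarrow> subtransversal U \<Omega> D \<longrightarrow> \<not> nullity r D > 0)"

section \<open>Activities\<close>

text \<open>A strict total order \<open>R\<close> on the skew classes is a set of pairs, with \<open>(\<omega>, \<omega>') \<in> R\<close> meaning
  that \<open>\<omega>\<close> precedes \<open>\<omega>'\<close>.  Elements are compared through the skew classes containing them.\<close>

definition induced_order :: "'a set set \<Rightarrow> 'a set rel \<Rightarrow> 'a rel" where
  "induced_order \<Omega> R = {(x, y). \<exists>\<omega>\<in>\<Omega>. \<exists>\<omega>'\<in>\<Omega>. x \<in> \<omega> \<and> y \<in> \<omega>' \<and> (\<omega>, \<omega>') \<in> R}"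

definition min_elem :: "'a set set \<Rightarrow> 'a set rel \<Rightarrow> 'a set \<Rightarrow> 'a" where
  "min_elem \<Omega> R C = (THE e. e \<in> C \<and> (\<forall>f\<in>C - {e}. (e, f) \<in> induced_order \<Omega> R))"

definition active ::
  "'a set \<Rightarrow> 'a set set \<Rightarrow> ('a set \<Rightarrow> nat) \<Rightarrow> 'a set rel \<Rightarrow> 'a set \<Rightarrow> 'a set \<Rightarrow> bool" where
  "active U \<Omega> r R T \<omega> \<longleftrightarrow> (\<exists>C. circuit U \<Omega> r C \<and> min_elem \<Omega> R C \<in> \<omega> \<and> C - \<omega> \<subseteq> T)"

definition act ::
  "'a set \<Rightarrow> 'a set set \<Rightarrow> ('a set \<Rightarrow> nat) \<Rightarrow> 'a set rel \<Rightarrow> 'a set \<Rightarrow> 'a set set" where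
  "act U \<Omega> r R T = {\<omega> \<in> \<Omega>. active U \<Omega> r R T \<omega>}"

definition inact ::
  "'a set \<Rightarrow> 'a set set \<Rightarrow> ('a set \<Rightarrow> nat) \<Rightarrow> 'a set rel \<Rightarrow> 'a set \<Rightarrow> 'a set set" where
  "inact U \<Omega> r R T = {\<omega> \<in> \<Omega>. \<not> active U \<Omega> r R T \<omega>}"

definition cocompatible ::
  "'a set \<Rightarrow> 'a set set \<Rightarrow> ('a set \<Rightarrow> nat) \<Rightarrow> 'a set rel \<Rightarrow> 'a set \<Rightarrow> bool" where
  "cocompatible U \<Omega> r R S \<longleftrightarrow>
     transversal U \<Omega> S \<and> \<not> (\<exists>C. circuit U \<Omega> r C \<and> C - S = {min_elem \<Omega> R C})"

definition Comp ::
  "'a set \<Rightarrow> 'a set set \<Rightarrow> ('a set \<Rightarrow> nat) \<Rightarrow> 'a set rel \<Rightarrow> 'a set set" where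
  "Comp U \<Omega> r R = {S. cocompatible U \<Omega> r R S}"

text \<open>For a transversal \<open>T\<close> and a skew class \<open>\<omega>\<close>, \<open>elem_at T \<omega>\<close> is \<open>T\<^sub>\<omega>\<close>.\<close>

definition elem_at :: "'a set \<Rightarrow> 'a set \<Rightarrow> 'a" where
  "elem_at T \<omega> = the_elem (T \<inter> \<omega>)"

section \<open>The transition polynomial\<close>

text \<open>Polynomials over the integers in the indeterminates \<open>x\<^sub>u\<close> and \<open>t\<close>: a monomial is a finitely
  supported exponent vector, and a polynomial is a finitely supported function from monomials to
  coefficients, multiplied by convolution.\<close>

datatype 'a indet = X_idx 'a | T_idx

type_synonym 'a mpoly = "('a indet \<Rightarrow>\<^sub>0 nat) \<Rightarrow>\<^sub>0 int"

definition indeterminate :: "'a indet \<Rightarrow> 'a mpoly" where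
  "indeterminate v = Poly_Mapping.single (Poly_Mapping.single v 1) 1"

definition var_x :: "'a \<Rightarrow> 'a mpoly" where
  "var_x u = indeterminate (X_idx u)"

definition var_t :: "'a mpoly" where
  "var_t = indeterminate T_idx"

definition Q :: "'a set \<Rightarrow> 'a set set \<Rightarrow> ('a set \<Rightarrow> nat) \<Rightarrow> 'a mpoly" where
  "Q U \<Omega> r = (\<Sum>T | transversal U \<Omega> T. var_t ^ nullity r T * (\<Prod>u\<in>T. var_x u))"

end

(* Build a transversal T one skew class at a time, from the last class to the first. By (R2), at most
   one element x of a class w is spanned by the later elements of T. Such an x exists iff w is active,
   T is cocompatible iff it picks x in every active class, and the nullity of T counts the classes
   where T picks x. If w is active then replacing the element of T in w by any other one does not
   change which elements are spanned in any class. Hence replacing the choices of T in its active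
   classes by the spanned elements maps transversals onto cocompatible ones, and the fibre over S
   consists of the transversals that agree with S on the inactive classes of S. The sum over this
   fibre factors into the product over the classes. *)

theory Submission
  imports Defs "HOL-Library.FuncSet"
begin

locale ordered_multimatroid =
  fixes U :: "'a set" and \<Omega> :: "'a set set" and r :: "'a set \<Rightarrow> nat" and R :: "'a set rel"
  assumes mm: "multimatroid U \<Omega> r"
    and order: "strict_linear_order_on \<Omega> R"
begin

section \<open>Carriers, subtransversals and transversals\<close>

lemma finite_U: "finite U"
  and Union_classes: "\<Union>\<Omega> = U"
  and class_nonempty: "\<omega> \<in> \<Omega> \<Longrightarrow> \<omega> \<noteq> {}"
  using mm by (auto simp: multimatroid_def is_carrier_def partition_on_def)

lemma class_subset: "\<omega> \<in> \<Omega> \<Longrightarrow> \<omega> \<subseteq> U"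
  using Union_classes by auto

lemma class_unique: "\<omega> \<in> \<Omega> \<Longrightarrow> \<omega>' \<in> \<Omega> \<Longrightarrow> x \<in> \<omega> \<Longrightarrow> x \<in> \<omega>' \<Longrightarrow> \<omega> = \<omega>'"
  using mm by (auto simp: multimatroid_def is_carrier_def partition_on_def disjoint_def)

lemma finite_class: "\<omega> \<in> \<Omega> \<Longrightarrow> finite \<omega>"
  using class_subset finite_U finite_subset by blast

lemma finite_classes: "finite \<Omega>"
  using Union_classes finite_U by (simp add: finite_UnionD)

lemma subtransversal_iff:
  "subtransversal U \<Omega> S \<longleftrightarrow> S \<subseteq> U \<and> (\<forall>\<omega>\<in>\<Omega>. \<forall>x\<in>S \<inter> \<omega>. \<forall>y\<in>S \<inter> \<omega>. x = y)"
proof -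
  have "card (S \<inter> \<omega>) \<le> 1 \<longleftrightarrow> (\<forall>x\<in>S \<inter> \<omega>. \<forall>y\<in>S \<inter> \<omega>. x = y)" if "\<omega> \<in> \<Omega>" for \<omega>
    using card_le_Suc0_iff_eq[of "S \<inter> \<omega>"] finite_class[OF that] by simp
  then show ?thesis
    by (simp add: subtransversal_def)
qed

lemma transversal_elem_at:
  "transversal U \<Omega> T \<Longrightarrow> \<omega> \<in> \<Omega> \<Longrightarrow> T \<inter> \<omega> = {elem_at T \<omega>}"
  unfolding transversal_def elem_at_def by (metis card_1_singletonE the_elem_eq)

lemma transversal_iff:
  "transversal U \<Omega> T \<longleftrightarrow> T \<subseteq> U \<and> (\<forall>\<omega>\<in>\<Omega>. \<exists>x. T \<inter> \<omega> = {x})"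
  unfolding transversal_def by (simp add: card_1_singleton_iff)

lemma subtransversal_mono: "subtransversal U \<Omega> S \<Longrightarrow> S' \<subseteq> S \<Longrightarrow> subtransversal U \<Omega> S'"
  unfolding subtransversal_iff by blast

lemma transversal_imp_subtransversal: "transversal U \<Omega> T \<Longrightarrow> subtransversal U \<Omega> T"
  by (simp add: transversal_def subtransversal_def)

lemma subtransversal_update:
  assumes "subtransversal U \<Omega> S" "\<omega> \<in> \<Omega>" "x \<in> \<omega>"
  shows "subtransversal U \<Omega> (insert x (S - \<omega>))"
  unfolding subtransversal_iff
proof (intro conjI ballI)
  show "insert x (S - \<omega>) \<subseteq> U"
    using assms class_subset by (auto simp: subtransversal_iff)
  fix \<omega>' y z assume "\<omega>' \<in> \<Omega>" "y \<in> insert x (S - \<omega>) \<inter> \<omega>'" "z \<in> insert x (S - \<omega>) \<inter> \<omega>'"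
  then show "y = z"
    using assms class_unique[of \<omega> \<omega>' x] by (auto simp: subtransversal_iff)
qed

text \<open>Skew classes are non-empty, so a representative can be chosen in each class that
  \<open>S\<close> misses. This carries (R1) from transversals over to subtransversals.\<close>

lemma subtransversal_extends:
  assumes "subtransversal U \<Omega> S"
  obtains T where "transversal U \<Omega> T" "S \<subseteq> T"
proof -
  define T where "T = S \<union> (\<lambda>\<omega>. SOME x. x \<in> \<omega>) ` {\<omega> \<in> \<Omega>. S \<inter> \<omega> = {}}"
  have some: "(SOME x. x \<in> \<omega>) \<in> \<omega>" if "\<omega> \<in> \<Omega>" for \<omega>
    using class_nonempty[OF that] by (simp add: some_in_eq)
  have "T \<inter> \<omega> = (if S \<inter> \<omega> = {} then {SOME x. x \<in> \<omega>} else S \<inter> \<omega>)" if \<omega>: "\<omega> \<in> \<Omega>" for \<omega>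
  proof -
    have "\<omega>' = \<omega>" if "\<omega>' \<in> \<Omega>" "(SOME x. x \<in> \<omega>') \<in> \<omega>" for \<omega>'
      using class_unique[OF that(1) \<omega> some that(2)] that(1) by blast
    then show ?thesis
      using some[OF \<omega>] \<omega> unfolding T_def by auto
  qed
  moreover have "\<exists>x. S \<inter> \<omega> = {x}" if "\<omega> \<in> \<Omega>" "S \<inter> \<omega> \<noteq> {}" for \<omega>
    using assms that unfolding subtransversal_iff by blast
  moreover have "T \<subseteq> U"
    using assms some class_subset unfolding T_def subtransversal_iff by blast
  ultimately have "transversal U \<Omega> T"
    unfolding transversal_iff by auto
  then show thesis
    using that T_def by blast
qed

lemma transversal_eqI:
  assumes "transversal U \<Omega> S" "transversal U \<Omega> T" "\<And>\<omega>. \<omega> \<in> \<Omega> \<Longrightarrow> S \<inter> \<omega> = T \<inter> \<omega>"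
  shows "S = T"
proof -
  have "S = (\<Union>\<omega>\<in>\<Omega>. S \<inter> \<omega>)" "T = (\<Union>\<omega>\<in>\<Omega>. T \<inter> \<omega>)"
    using assms(1,2) Union_classes by (auto simp: transversal_def)
  then show ?thesis
    using assms(3) by auto
qed

lemma finite_transversals: "finite {T. transversal U \<Omega> T}"
  by (rule finite_subset[of _ "Pow U"]) (auto simp: transversal_def finite_U)

lemma finite_subtransversal: "subtransversal U \<Omega> S \<Longrightarrow> finite S"
  using finite_U finite_subset by (auto simp: subtransversal_def)

section \<open>Matroid rank on subtransversals\<close>

lemma rank_matroid: "subtransversal U \<Omega> S \<Longrightarrow> matroid_rank_function S r"
proof -
  assume "subtransversal U \<Omega> S"
  then obtain T where T: "transversal U \<Omega> T" "S \<subseteq> T"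
    using subtransversal_extends by blast
  then have "matroid_rank_function T r"
    using mm by (auto simp: multimatroid_def)
  with T(2) show ?thesis
    unfolding matroid_rank_function_def by (meson subset_trans)
qed

lemma rank_le_card: "subtransversal U \<Omega> S \<Longrightarrow> r S \<le> card S"
  using rank_matroid unfolding matroid_rank_function_def by blast

lemma rank_mono: "subtransversal U \<Omega> S \<Longrightarrow> A \<subseteq> S \<Longrightarrow> r A \<le> r S"
  using rank_matroid unfolding matroid_rank_function_def by blast

lemma rank_submodular:
  "subtransversal U \<Omega> S \<Longrightarrow> A \<subseteq> S \<Longrightarrow> B \<subseteq> S \<Longrightarrow> r (A \<union> B) + r (A \<inter> B) \<le> r A + r B"
  using rank_matroid unfolding matroid_rank_function_def by blast

lemma rank_empty: "r {} = 0"
  using rank_le_card[of "{}"] by (simp add: subtransversal_def)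

lemma rank_insert_le:
  assumes "subtransversal U \<Omega> (insert x S)"
  shows "r (insert x S) \<le> Suc (r S)"
proof -
  have "r (S \<union> {x}) + r (S \<inter> {x}) \<le> r S + r {x}"
    using rank_submodular[OF assms] by blast
  moreover have "r {x} \<le> 1"
    using rank_le_card[of "{x}"] subtransversal_mono[OF assms] by simp
  ultimately show ?thesis
    by simp
qed

text \<open>Monotonicity of closure: submodularity for \<open>insert x A\<close> and
  \<open>B\<close>, whose intersection still contains \<open>A\<close>, bounds the increase at
  \<open>B\<close> by the increase at \<open>A\<close>.\<close>

lemma rank_insert_mono:
  assumes "subtransversal U \<Omega> (insert x B)" "A \<subseteq> B" "r (insert x A) = r A"
  shows "r (insert x B) = r B"
proof -
  have "r (insert x A \<union> B) + r (insert x A \<inter> B) \<le> r (insert x A) + r B"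
    using assms by (intro rank_submodular[OF assms(1)]) auto
  moreover have "r A \<le> r (insert x A \<inter> B)"
    using assms by (intro rank_mono subtransversal_mono[OF assms(1)]) auto
  moreover have "r B \<le> r (insert x B)"
    using assms by (intro rank_mono) auto
  moreover have "insert x A \<union> B = insert x B"
    using assms by auto
  ultimately show ?thesis
    using assms(3) by simp
qed

text \<open>If two distinct elements both left the rank unchanged, the left-hand side of (R2) would
  be 0.\<close>

lemma skew_pair_not_both_spanned:
  assumes "subtransversal U \<Omega> S" "\<omega> \<in> \<Omega>" "\<omega> \<inter> S = {}" "x \<in> \<omega>" "y \<in> \<omega>"
    and "r (insert x S) = r S" "r (insert y S) = r S"
  shows "x = y"
proof (rule ccontr)
  assume "x \<noteq> y"
  then have "int (r (S \<union> {x})) + int (r (S \<union> {y})) - 2 * int (r S) \<ge> 1"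
    using mm assms(1-5) unfolding multimatroid_def by blast
  then show False
    using assms(6,7) by simp
qed

section \<open>Elements spanned by the later choices of a transversal\<close>

definition above :: "'a set \<Rightarrow> 'a set \<Rightarrow> 'a set" where
  "above T \<omega> = {u \<in> T. \<exists>\<omega>'\<in>\<Omega>. (\<omega>, \<omega>') \<in> R \<and> u \<in> \<omega>'}"

text \<open>This is the part of the class lying in the matroid closure of the later choices of
  \<open>T\<close>. It depends only on those choices, so it can be read off before \<open>T\<close>
  chooses in \<omega>.\<close>

definition spanned :: "'a set \<Rightarrow> 'a set \<Rightarrow> 'a set" where
  "spanned T \<omega> = {x \<in> \<omega>. r (insert x (above T \<omega>)) = r (above T \<omega>)}"

lemma R_irrefl: "(\<omega>, \<omega>) \<notin> R"
  and R_trans: "(\<omega>, \<omega>') \<in> R \<Longrightarrow> (\<omega>', \<omega>'') \<in> R \<Longrightarrow> (\<omega>, \<omega>'') \<in> R"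
  and R_total: "\<omega> \<in> \<Omega> \<Longrightarrow> \<omega>' \<in> \<Omega> \<Longrightarrow> \<omega> \<noteq> \<omega>' \<Longrightarrow> (\<omega>, \<omega>') \<in> R \<or> (\<omega>', \<omega>) \<in> R"
  using order unfolding strict_linear_order_on_def irrefl_def total_on_def
  by (auto dest: transD)

lemma least_class:
  assumes "F \<subseteq> \<Omega>" "F \<noteq> {}"
  obtains m where "m \<in> F" "\<And>\<omega>. \<omega> \<in> F - {m} \<Longrightarrow> (m, \<omega>) \<in> R"
proof -
  \<comment> \<open>Cutting \<open>R\<close> down to \<open>F\<close> makes it finite. A finite
    acyclic relation is well-founded, and a minimal class is least by totality.\<close>
  have "trans (R \<inter> F \<times> F)"
    using R_trans by (auto intro: transI)
  then have "acyclic (R \<inter> F \<times> F)"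
    by (simp add: acyclic_def R_irrefl)
  moreover have "finite (R \<inter> F \<times> F)"
    using assms finite_classes finite_subset by blast
  ultimately have "wf (R \<inter> F \<times> F)"
    by (simp add: finite_acyclic_wf)
  then obtain m where m: "m \<in> F" "\<And>\<omega>. (\<omega>, m) \<in> R \<inter> F \<times> F \<Longrightarrow> \<omega> \<notin> F"
    using assms(2) wfE_min' by metis
  show thesis
  proof (rule that[OF m(1)])
    fix \<omega> assume \<omega>: "\<omega> \<in> F - {m}"
    then have "(\<omega>, m) \<notin> R"
      using m by blast
    then show "(m, \<omega>) \<in> R"
      using R_total[of m \<omega>] m(1) \<omega> assms(1) by blast
  qed
qed

lemma above_subset: "above T \<omega> \<subseteq> T"
  by (auto simp: above_def)

lemma above_disjoint: "\<omega> \<in> \<Omega> \<Longrightarrow> \<omega> \<inter> above T \<omega> = {}"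
  using R_irrefl class_unique by (fastforce simp: above_def)

lemma subtransversal_above: "transversal U \<Omega> T \<Longrightarrow> subtransversal U \<Omega> (above T \<omega>)"
  using above_subset subtransversal_mono transversal_imp_subtransversal by blast

lemma subtransversal_insert:
  assumes "subtransversal U \<Omega> S" "\<omega> \<in> \<Omega>" "x \<in> \<omega>" "\<omega> \<inter> S = {}"
  shows "subtransversal U \<Omega> (insert x S)"
  using subtransversal_update[OF assms(1-3)] assms(4) by (simp add: Diff_triv Int_commute)

lemma spanned_unique:
  assumes "transversal U \<Omega> T" "\<omega> \<in> \<Omega>" "x \<in> spanned T \<omega>" "y \<in> spanned T \<omega>"
  shows "x = y"
  using assms(3,4)
    skew_pair_not_both_spanned[OF subtransversal_above[OF assms(1)] assms(2) above_disjoint[OF assms(2)]]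
  unfolding spanned_def by blast

section \<open>Invariance under changes in active classes\<close>

text \<open>If \<open>A\<close> spans an element \<open>x\<close> of \<open>\<omega>0\<close> but does not span \<open>y\<close>, and \<open>A \<union> {e}\<close> spans \<open>y\<close>, then
  \<open>A \<union> {y}\<close> spans both \<open>x\<close> and \<open>e\<close>, so \<open>x = e\<close> by (R2).\<close>

lemma rank_insert_iff_without_spanned_class:
  assumes A: "subtransversal U \<Omega> A" "\<omega> \<in> \<Omega>" "\<omega> \<inter> A = {}" "y \<in> \<omega>"
    and A0: "\<omega>0 \<in> \<Omega>" "\<omega>0 \<inter> A = {}" "\<omega> \<noteq> \<omega>0"
    and x: "x \<in> \<omega>0" "r (insert x A) = r A" and e: "e \<in> \<omega>0"
  shows "r (insert y (insert e A)) = r (insert e A) \<longleftrightarrow> r (insert y A) = r A"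
proof -
  have disj: "\<omega> \<inter> \<omega>0 = {}"
    using class_unique A(2) A0 by blast
  have y: "subtransversal U \<Omega> (insert y A)"
    using subtransversal_insert[OF A(1,2,4,3)] .
  have yA: "\<omega>0 \<inter> insert y A = {}"
    using A(4) A0(2) disj by blast
  have sub1: "subtransversal U \<Omega> (insert z A)" if "z \<in> \<omega>0" for z
    using subtransversal_insert[OF A(1) A0(1) that A0(2)] .
  have sub2: "subtransversal U \<Omega> (insert y (insert z A))" if "z \<in> \<omega>0" for z
    using subtransversal_insert[OF y A0(1) that yA] by (simp add: insert_commute)
  show ?thesis
  proof
    assume "r (insert y A) = r A"
    then show "r (insert y (insert e A)) = r (insert e A)"
      by (rule rank_insert_mono[OF sub2[OF e] subset_insertI])
  next
    assume span: "r (insert y (insert e A)) = r (insert e A)"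
    show "r (insert y A) = r A"
    proof (rule ccontr)
      assume "r (insert y A) \<noteq> r A"
      then have "r (insert y A) = Suc (r A)"
        using rank_insert_le[of y A] rank_mono[of "insert y A" A] y by fastforce
      moreover have "r (insert e A) \<le> Suc (r A)"
        using rank_insert_le sub1[OF e] by blast
      moreover have "r (insert y A) \<le> r (insert e (insert y A))"
        using rank_mono[OF sub2[OF e]] by (simp add: insert_commute subset_insertI)
      \<comment> \<open>A squeeze: \<open>insert y A\<close> already has rank
        \<open>Suc (r A)\<close>, and adding \<open>e\<close> to it gives the rank of
        \<open>insert e A\<close>, which is at most \<open>Suc (r A)\<close>.\<close>
      ultimately have "r (insert e (insert y A)) = r (insert y A)"
        using span by (simp add: insert_commute)
      moreover have "r (insert x (insert y A)) = r (insert y A)"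
        using rank_insert_mono[of x "insert y A" A] sub2[OF x(1)] x(2) by (auto simp: insert_commute)
      ultimately have "x = e"
        using skew_pair_not_both_spanned[OF y A0(1) yA x(1) e] by blast
      \<comment> \<open>The case \<open>x = e\<close> is impossible too: then \<open>e\<close> and
        \<open>y\<close> together leave the rank at \<open>r A\<close>, although \<open>y\<close>
        alone raises it.\<close>
      then have "r (insert e A) = r A"
        using x(2) by simp
      with span have "r (insert y (insert e A)) = r A"
        by simp
      moreover have "r (insert y A) \<le> r (insert y (insert e A))"
        using rank_mono[OF sub2[OF e]] by blast
      ultimately show False
        using \<open>r (insert y A) = Suc (r A)\<close> by simp
    qed
  qed
qed

text \<open>Only classes before \<omega>0 see the change. For such a class, the later choices are a
  common set \<open>A\<close> outside \<omega>0 plus one element of \<omega>0. Since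
  \<open>A\<close> already spans some element of \<omega>0, either choice there spans the same
  elements of \<omega> as \<open>A\<close> does.\<close>

lemma spanned_cong_one_class:
  assumes T: "transversal U \<Omega> T" "transversal U \<Omega> T'" and \<omega>0: "\<omega>0 \<in> \<Omega>" "spanned T \<omega>0 \<noteq> {}"
    and agree: "\<And>\<omega>. \<omega> \<in> \<Omega> \<Longrightarrow> \<omega> \<noteq> \<omega>0 \<Longrightarrow> T \<inter> \<omega> = T' \<inter> \<omega>"
    and \<omega>: "\<omega> \<in> \<Omega>"
  shows "spanned T \<omega> = spanned T' \<omega>"
proof (cases "(\<omega>, \<omega>0) \<in> R")
  case False
  then have "above T \<omega> = above T' \<omega>"
    using agree unfolding above_def by blast
  then show ?thesis
    by (simp add: spanned_def)
next
  case True
  define A where "A = above T \<omega> - \<omega>0"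
  obtain x where x: "x \<in> \<omega>0" "r (insert x (above T \<omega>0)) = r (above T \<omega>0)"
    using \<omega>0(2) by (auto simp: spanned_def)
  have disj: "\<omega> \<inter> A = {}" "\<omega>0 \<inter> A = {}"
    using above_disjoint[OF \<omega>] A_def by auto
  have sub: "subtransversal U \<Omega> A"
    using subtransversal_above[OF T(1)] subtransversal_mono A_def by blast
  \<comment> \<open>By transitivity everything after \<omega>0 is also after \<omega>, so
    \<open>A\<close> inherits the spanned element \<open>x\<close>.\<close>
  have "above T \<omega>0 \<subseteq> A"
    using above_disjoint[OF \<omega>0(1), of T] True R_trans unfolding A_def above_def by blast
  then have xA: "r (insert x A) = r A"
    using rank_insert_mono[OF subtransversal_insert[OF sub \<omega>0(1) x(1) disj(2)]] x(2) by blast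
  have ne: "\<omega> \<noteq> \<omega>0"
    using True R_irrefl by blast
  have "above S \<omega> = insert (elem_at S \<omega>0) A"
    if "transversal U \<Omega> S" "\<And>\<omega>. \<omega> \<in> \<Omega> \<Longrightarrow> \<omega> \<noteq> \<omega>0 \<Longrightarrow> T \<inter> \<omega> = S \<inter> \<omega>" for S
  proof -
    have "above S \<omega> = (S \<inter> \<omega>0) \<union> (above S \<omega> - \<omega>0)"
      using True \<omega>0(1) unfolding above_def by blast
    moreover have "above S \<omega> - \<omega>0 = A"
      using that(2) unfolding A_def above_def by blast
    ultimately show ?thesis
      using transversal_elem_at[OF that(1) \<omega>0(1)] by simp
  qed
  then have ab: "above T \<omega> = insert (elem_at T \<omega>0) A" "above T' \<omega> = insert (elem_at T' \<omega>0) A"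
    using T agree by auto
  have el: "elem_at T \<omega>0 \<in> \<omega>0" "elem_at T' \<omega>0 \<in> \<omega>0"
    using transversal_elem_at T \<omega>0(1) by blast+
  show ?thesis
    unfolding spanned_def ab
    using rank_insert_iff_without_spanned_class[OF sub \<omega> disj(1) _ \<omega>0(1) disj(2) ne x(1) xA] el
    by blast
qed

lemma transversal_update:
  assumes "transversal U \<Omega> T" "\<omega> \<in> \<Omega>" "x \<in> \<omega>"
  shows "transversal U \<Omega> (insert x (T - \<omega>))"
    and "insert x (T - \<omega>) \<inter> \<omega> = {x}"
    and "\<omega>' \<in> \<Omega> \<Longrightarrow> \<omega>' \<noteq> \<omega> \<Longrightarrow> insert x (T - \<omega>) \<inter> \<omega>' = T \<inter> \<omega>'"
proof -
  show here: "insert x (T - \<omega>) \<inter> \<omega> = {x}"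
    using assms by auto
  show there: "insert x (T - \<omega>) \<inter> \<omega>' = T \<inter> \<omega>'" if "\<omega>' \<in> \<Omega>" "\<omega>' \<noteq> \<omega>" for \<omega>'
    using assms class_unique that by blast
  show "transversal U \<Omega> (insert x (T - \<omega>))"
    unfolding transversal_iff
    using assms class_subset here there unfolding transversal_iff
    by (metis Diff_subset insert_subset subset_trans subsetD)
qed

text \<open>Induction on the set \<open>D\<close> of classes where \<open>T\<close> and
  \<open>T'\<close> may differ, moving \<open>T\<close> to \<open>T'\<close> one class at a time.
  Each move preserves all spanned sets, so the remaining classes of \<open>D\<close> still have a
  spanned element; hence \<open>T\<close> must be arbitrary in the induction.\<close>

lemma spanned_cong_on:
  assumes "finite D" "D \<subseteq> \<Omega>" "transversal U \<Omega> T" "transversal U \<Omega> T'"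
    and "\<And>\<omega>. \<omega> \<in> D \<Longrightarrow> spanned T \<omega> \<noteq> {}"
    and "\<And>\<omega>. \<omega> \<in> \<Omega> - D \<Longrightarrow> T \<inter> \<omega> = T' \<inter> \<omega>"
    and "\<omega> \<in> \<Omega>"
  shows "spanned T \<omega> = spanned T' \<omega>"
  using assms
proof (induction D arbitrary: T rule: finite_induct)
  case empty
  then have "T = T'"
    using transversal_eqI[OF empty.prems(2,3)] by simp
  then show ?case
    by simp
next
  case (insert \<omega>0 D)
  define S where "S = insert (elem_at T' \<omega>0) (T - \<omega>0)"
  have \<omega>0: "\<omega>0 \<in> \<Omega>"
    using insert.prems by simp
  have T': "T' \<inter> \<omega>0 = {elem_at T' \<omega>0}"
    using transversal_elem_at insert.prems(3) \<omega>0 by blast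
  then have el: "elem_at T' \<omega>0 \<in> \<omega>0"
    by blast
  note S = transversal_update[OF insert.prems(2) \<omega>0 el, folded S_def]
  have one: "spanned T \<omega> = spanned S \<omega>" if "\<omega> \<in> \<Omega>" for \<omega>
    using insert.prems S that by (intro spanned_cong_one_class[OF _ _ \<omega>0]) auto
  have "spanned S \<omega> = spanned T' \<omega>"
  proof (rule insert.IH)
    show "S \<inter> \<omega> = T' \<inter> \<omega>" if "\<omega> \<in> \<Omega> - D" for \<omega>
      using that S T' insert.prems(5)[of \<omega>] by (cases "\<omega> = \<omega>0") auto
  qed (use insert.prems S(1) one[symmetric] in auto)
  with one show ?case
    using insert.prems by blast
qed

lemma spanned_cong:
  assumes "transversal U \<Omega> T" "transversal U \<Omega> T'"
    and "\<And>\<omega>. \<omega> \<in> \<Omega> \<Longrightarrow> spanned T \<omega> = {} \<Longrightarrow> T \<inter> \<omega> = T' \<inter> \<omega>"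
    and "\<omega> \<in> \<Omega>"
  shows "spanned T \<omega> = spanned T' \<omega>"
  using assms finite_classes by (intro spanned_cong_on[of "{\<omega> \<in> \<Omega>. spanned T \<omega> \<noteq> {}}"]) auto

section \<open>Circuits, activity and cocompatibility in terms of spanned elements\<close>

lemma min_elem_eqI:
  assumes "subtransversal U \<Omega> C" "\<omega> \<in> \<Omega>" "x \<in> C \<inter> \<omega>"
    and "\<And>y. y \<in> C - {x} \<Longrightarrow> \<exists>\<omega>'\<in>\<Omega>. (\<omega>, \<omega>') \<in> R \<and> y \<in> \<omega>'"
  shows "min_elem \<Omega> R C = x"
  unfolding min_elem_def
proof (rule the_equality)
  show "x \<in> C \<and> (\<forall>f\<in>C - {x}. (x, f) \<in> induced_order \<Omega> R)"
    using assms unfolding induced_order_def by blast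
  \<comment> \<open>A second minimum would lie in a class both before and after \<omega>, against
    transitivity and irreflexivity.\<close>
  fix e assume e: "e \<in> C \<and> (\<forall>f\<in>C - {e}. (e, f) \<in> induced_order \<Omega> R)"
  show "e = x"
  proof (rule ccontr)
    assume "e \<noteq> x"
    then have "(e, x) \<in> induced_order \<Omega> R"
      using e assms(3) by blast
    then obtain \<omega>1 \<omega>2 where 1: "\<omega>1 \<in> \<Omega>" "\<omega>2 \<in> \<Omega>" "e \<in> \<omega>1" "x \<in> \<omega>2" "(\<omega>1, \<omega>2) \<in> R"
      unfolding induced_order_def by blast
    obtain \<omega>3 where 3: "\<omega>3 \<in> \<Omega>" "(\<omega>, \<omega>3) \<in> R" "e \<in> \<omega>3"
      using assms(4) e \<open>e \<noteq> x\<close> by blast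
    have "\<omega>2 = \<omega>" "\<omega>1 = \<omega>3"
      using class_unique[of \<omega>2 \<omega> x] class_unique[of \<omega>1 \<omega>3 e] 1 3 assms by auto
    then show False
      using 1 3 R_trans R_irrefl by blast
  qed
qed

text \<open>The class \<omega> is the least one meeting \<open>C\<close>; the other elements of
  \<open>C\<close> lie in other classes because \<open>C\<close> is a subtransversal.\<close>

lemma min_elem_properties:
  assumes C: "subtransversal U \<Omega> C" "C \<noteq> {}"
  obtains \<omega> where "\<omega> \<in> \<Omega>" "min_elem \<Omega> R C \<in> C \<inter> \<omega>"
    "\<And>y. y \<in> C - {min_elem \<Omega> R C} \<Longrightarrow> \<exists>\<omega>'\<in>\<Omega>. (\<omega>, \<omega>') \<in> R \<and> y \<in> \<omega>'"
proof -
  have cover: "\<exists>\<omega>\<in>\<Omega>. y \<in> \<omega>" if "y \<in> C" for y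
    using C(1) that Union_classes unfolding subtransversal_def by blast
  then have "{\<omega> \<in> \<Omega>. C \<inter> \<omega> \<noteq> {}} \<noteq> {}"
    using C(2) by blast
  then obtain m where m: "m \<in> \<Omega>" "C \<inter> m \<noteq> {}"
    "\<And>\<omega>. \<omega> \<in> {\<omega> \<in> \<Omega>. C \<inter> \<omega> \<noteq> {}} - {m} \<Longrightarrow> (m, \<omega>) \<in> R"
    using least_class[of "{\<omega> \<in> \<Omega>. C \<inter> \<omega> \<noteq> {}}"] by blast
  then obtain x where x: "x \<in> C \<inter> m"
    by blast
  have later: "\<exists>\<omega>'\<in>\<Omega>. (m, \<omega>') \<in> R \<and> y \<in> \<omega>'" if y: "y \<in> C - {x}" for y
  proof -
    obtain \<omega>' where \<omega>': "\<omega>' \<in> \<Omega>" "y \<in> \<omega>'"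
      using cover y by blast
    moreover have "\<omega>' \<noteq> m"
      using C(1) y x \<omega>' m(1) unfolding subtransversal_iff by blast
    ultimately show ?thesis
      using m(3)[of \<omega>'] y by blast
  qed
  show thesis
    using that[OF m(1)] min_elem_eqI[OF C(1) m(1) x later] x later by blast
qed

lemma circuit_subtransversal: "circuit U \<Omega> r C \<Longrightarrow> subtransversal U \<Omega> C"
  by (simp add: circuit_def)

lemma circuit_nonempty: "circuit U \<Omega> r C \<Longrightarrow> C \<noteq> {}"
  by (auto simp: circuit_def nullity_def)

text \<open>By minimality \<open>C - {x}\<close> has full rank \<open>card C - 1\<close>, and the
  rank of the dependent set \<open>C\<close> is no larger.\<close>

lemma circuit_rank_delete:
  assumes C: "circuit U \<Omega> r C" and x: "x \<in> C"
  shows "r C = r (C - {x})"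
proof -
  have fin: "finite C"
    using C circuit_subtransversal finite_subtransversal by blast
  have sub: "subtransversal U \<Omega> (C - {x})"
    using subtransversal_mono[OF circuit_subtransversal[OF C]] by blast
  have "C - {x} \<subset> C"
    using x by blast
  then have "\<not> nullity r (C - {x}) > 0"
    using C sub unfolding circuit_def by blast
  then have "card (C - {x}) \<le> r (C - {x})"
    by (simp add: nullity_def)
  moreover have "r C < card C"
    using C by (simp add: circuit_def nullity_def)
  moreover have "card C = Suc (card (C - {x}))"
    using card.remove[OF fin x] .
  moreover have "r (C - {x}) \<le> r C"
    by (rule rank_mono[OF circuit_subtransversal[OF C]]) blast
  ultimately show ?thesis
    by simp
qed

text \<open>All elements of \<open>C\<close> other than its minimum lie in later classes and belong
  to \<open>T\<close>. They span the minimum, and so does the larger set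
  \<open>above T \<omega>\<close>.\<close>

lemma min_elem_in_spanned:
  assumes T: "transversal U \<Omega> T" and \<omega>: "\<omega> \<in> \<Omega>" and C: "circuit U \<Omega> r C"
    and m: "min_elem \<Omega> R C \<in> \<omega>" and CT: "C - \<omega> \<subseteq> T"
  shows "min_elem \<Omega> R C \<in> spanned T \<omega>"
proof -
  let ?m = "min_elem \<Omega> R C"
  note subC = circuit_subtransversal[OF C]
  obtain \<omega>' where \<omega>': "\<omega>' \<in> \<Omega>" "?m \<in> C \<inter> \<omega>'"
    "\<And>y. y \<in> C - {?m} \<Longrightarrow> \<exists>\<omega>''\<in>\<Omega>. (\<omega>', \<omega>'') \<in> R \<and> y \<in> \<omega>''"
    using min_elem_properties[OF subC circuit_nonempty[OF C]] by blast
  have eq: "\<omega>' = \<omega>"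
    using class_unique[OF \<omega>'(1) \<omega> _ m] \<omega>'(2) by blast
  have "C - {?m} \<subseteq> above T \<omega>"
  proof
    fix y assume y: "y \<in> C - {?m}"
    then have "y \<notin> \<omega>"
      using subC \<omega> m \<omega>'(2) unfolding subtransversal_iff by blast
    then show "y \<in> above T \<omega>"
      using CT y \<omega>'(3)[OF y] unfolding eq above_def by blast
  qed
  moreover have "insert ?m (C - {?m}) = C"
    using \<omega>'(2) by blast
  then have "r (insert ?m (C - {?m})) = r (C - {?m})"
    using circuit_rank_delete[OF C, of ?m] \<omega>'(2) by simp
  moreover have "subtransversal U \<Omega> (insert ?m (above T \<omega>))"
    using subtransversal_insert[OF subtransversal_above[OF T] \<omega> m above_disjoint[OF \<omega>]] .
  ultimately show ?thesis
    using m rank_insert_mono unfolding spanned_def by blast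
qed

text \<open>A basis is obtained as a minimal subset of full rank.\<close>

lemma independent_spanning_subset:
  assumes S: "subtransversal U \<Omega> S"
  obtains I where "I \<subseteq> S" "r I = card I" "r I = r S"
proof -
  have fin: "finite S"
    using S finite_subtransversal by blast
  have "finite {I. I \<subseteq> S \<and> r I = r S}" "{I. I \<subseteq> S \<and> r I = r S} \<noteq> {}"
    using fin by auto
  from finite_has_minimal[OF this] obtain I where "I \<in> {I. I \<subseteq> S \<and> r I = r S}"
    "\<forall>J\<in>{I. I \<subseteq> S \<and> r I = r S}. J \<subseteq> I \<longrightarrow> I = J"
    by (rule bexE)
  then have I: "I \<subseteq> S" "r I = r S"
    and min: "J \<subseteq> S \<Longrightarrow> r J = r S \<Longrightarrow> J \<subseteq> I \<Longrightarrow> I = J" for J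
    by simp_all
  have "finite I"
    using I(1) fin finite_subset by blast
  \<comment> \<open>Building \<open>I\<close> up element by element, each step raises the rank: an
    element \<open>d\<close> spanned by the earlier ones would be spanned by \<open>I - {d}\<close>
    and could be dropped from \<open>I\<close>.\<close>
  have "E \<subseteq> I \<Longrightarrow> r E = card E" if "finite E" for E
    using that
  proof (induction E rule: finite_induct)
    case empty
    then show ?case
      by (simp add: rank_empty)
  next
    case (insert d E)
    have sub: "subtransversal U \<Omega> (insert d (I - {d}))" "subtransversal U \<Omega> (insert d E)"
      using I(1) insert.prems by (auto intro: subtransversal_mono[OF S])
    have "r (insert d E) \<noteq> r E"
    proof
      assume "r (insert d E) = r E"
      then have "r (insert d (I - {d})) = r (I - {d})"
        using insert by (intro rank_insert_mono[OF sub(1), of E]) auto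
      moreover have "insert d (I - {d}) = I"
        using insert.prems by blast
      ultimately have "I = I - {d}"
        using I by (intro min) auto
      then show False
        using insert.prems by blast
    qed
    then show ?case
      using rank_insert_le[OF sub(2)] rank_mono[OF sub(2), of E] insert by fastforce
  qed
  then show thesis
    using that[OF I(1) _ I(2)] \<open>finite I\<close> by blast
qed

text \<open>The fundamental circuit of \<open>x\<close> over a basis \<open>I\<close> of
  \<open>above T \<omega>\<close>: \<open>insert x I\<close> is dependent, and a minimal dependent
  subset of it must contain \<open>x\<close>, since every subset of \<open>I\<close> is independent.
  The rest of it lies in later classes, so \<open>x\<close> is its minimum.\<close>

lemma spanned_imp_circuit:
  assumes T: "transversal U \<Omega> T" and \<omega>: "\<omega> \<in> \<Omega>" and x: "x \<in> spanned T \<omega>"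
  obtains C where "circuit U \<Omega> r C" "x \<in> C" "min_elem \<Omega> R C = x" "C - {x} \<subseteq> above T \<omega>"
proof -
  have x': "x \<in> \<omega>" "r (insert x (above T \<omega>)) = r (above T \<omega>)"
    using x by (auto simp: spanned_def)
  have sub: "subtransversal U \<Omega> (insert x (above T \<omega>))"
    using subtransversal_insert[OF subtransversal_above[OF T] \<omega> x'(1) above_disjoint[OF \<omega>]] .
  obtain I where I: "I \<subseteq> above T \<omega>" "r I = card I" "r I = r (above T \<omega>)"
    using independent_spanning_subset[OF subtransversal_above[OF T]] by blast
  have subI: "subtransversal U \<Omega> (insert x I)"
    using subtransversal_mono[OF sub] I(1) by blast
  then have fin: "finite (insert x I)"
    by (rule finite_subtransversal)
  have "x \<notin> I"
    using I(1) x'(1) above_disjoint[OF \<omega>] by blast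
  moreover have "r (insert x I) \<le> r (insert x (above T \<omega>))"
    using I(1) by (intro rank_mono[OF sub]) blast
  ultimately have "nullity r (insert x I) > 0"
    using I x' fin by (simp add: nullity_def)
  then have "{D. D \<subseteq> insert x I \<and> nullity r D > 0} \<noteq> {}"
    by blast
  moreover have "finite {D. D \<subseteq> insert x I \<and> nullity r D > 0}"
    using fin by simp
  ultimately obtain C where "C \<in> {D. D \<subseteq> insert x I \<and> nullity r D > 0}"
    "\<forall>D\<in>{D. D \<subseteq> insert x I \<and> nullity r D > 0}. D \<subseteq> C \<longrightarrow> C = D"
    using finite_has_minimal[of "{D. D \<subseteq> insert x I \<and> nullity r D > 0}"] by meson
  then have C: "C \<subseteq> insert x I" "nullity r C > 0"
    and min: "D \<subseteq> insert x I \<Longrightarrow> nullity r D > 0 \<Longrightarrow> D \<subseteq> C \<Longrightarrow> C = D" for D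
    by simp_all
  have subC: "subtransversal U \<Omega> C"
    using subtransversal_mono[OF subI C(1)] .
  have circ: "circuit U \<Omega> r C"
    unfolding circuit_def using subC C min by blast
  have indep: "nullity r D = 0" if "D \<subseteq> I" for D
  proof -
    have subI': "subtransversal U \<Omega> I"
      using subtransversal_mono[OF subI] by blast
    \<comment> \<open>Splitting the basis gives
      \<open>card I = r I \<le> r D + card (I - D)\<close>, which forces
      \<open>card D \<le> r D\<close>.\<close>
    have "r (D \<union> (I - D)) + r (D \<inter> (I - D)) \<le> r D + r (I - D)"
      using that by (intro rank_submodular[OF subI']) auto
    moreover have "D \<union> (I - D) = I"
      using that by blast
    moreover have "r (I - D) \<le> card (I - D)"
      using rank_le_card subtransversal_mono[OF subI'] by blast
    moreover have "card (I - D) = card I - card D" "card D \<le> card I"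
      using that fin by (auto simp: card_Diff_subset finite_subset card_mono)
    ultimately have "card D \<le> r D"
      using I(2) by simp
    then show ?thesis
      by (simp add: nullity_def)
  qed
  have xC: "x \<in> C"
    using indep[of C] C by (metis gr_implies_not0 subset_insert)
  have CT: "C - {x} \<subseteq> above T \<omega>"
    using C(1) I(1) by blast
  have "min_elem \<Omega> R C = x"
    using xC x'(1) CT by (intro min_elem_eqI[OF subC \<omega>]) (auto simp: above_def)
  then show thesis
    using that circ xC CT by blast
qed

text \<open>A circuit witnessing activity yields its minimum as a spanned element, and a spanned
  element yields its fundamental circuit.\<close>

lemma active_iff:
  assumes "transversal U \<Omega> T" "\<omega> \<in> \<Omega>"
  shows "active U \<Omega> r R T \<omega> \<longleftrightarrow> spanned T \<omega> \<noteq> {}"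
proof
  assume "active U \<Omega> r R T \<omega>"
  then show "spanned T \<omega> \<noteq> {}"
    using min_elem_in_spanned[OF assms] unfolding active_def by blast
next
  assume "spanned T \<omega> \<noteq> {}"
  then obtain x where x: "x \<in> spanned T \<omega>"
    by blast
  then obtain C where "circuit U \<Omega> r C" "min_elem \<Omega> R C = x" "C - {x} \<subseteq> above T \<omega>"
    using spanned_imp_circuit[OF assms] by blast
  moreover have "x \<in> \<omega>"
    using x by (simp add: spanned_def)
  ultimately show "active U \<Omega> r R T \<omega>"
    using above_subset unfolding active_def by blast
qed

text \<open>The forbidden circuits are those that witness activity and whose minimum is missing from
  \<open>T\<close>; these minima are the spanned elements outside \<open>T\<close>.\<close>

lemma cocompatible_iff:
  "cocompatible U \<Omega> r R T \<longleftrightarrow> transversal U \<Omega> T \<and> (\<forall>\<omega>\<in>\<Omega>. spanned T \<omega> \<subseteq> T)"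
proof -
  have "(\<exists>C. circuit U \<Omega> r C \<and> C - T = {min_elem \<Omega> R C}) \<longleftrightarrow> (\<exists>\<omega>\<in>\<Omega>. \<not> spanned T \<omega> \<subseteq> T)"
    if T: "transversal U \<Omega> T"
  proof
    assume "\<exists>C. circuit U \<Omega> r C \<and> C - T = {min_elem \<Omega> R C}"
    then obtain C where C: "circuit U \<Omega> r C" "C - T = {min_elem \<Omega> R C}"
      by (elim exE conjE)
    obtain \<omega> where \<omega>: "\<omega> \<in> \<Omega>" "min_elem \<Omega> R C \<in> C \<inter> \<omega>"
      using min_elem_properties[OF circuit_subtransversal[OF C(1)] circuit_nonempty[OF C(1)]] by blast
    then have "C - \<omega> \<subseteq> T"
      using C(2) by (metis Diff_iff IntE singletonD subsetI)
    then have "min_elem \<Omega> R C \<in> spanned T \<omega>"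
      using C(1) \<omega> by (intro min_elem_in_spanned[OF T]) auto
    then show "\<exists>\<omega>\<in>\<Omega>. \<not> spanned T \<omega> \<subseteq> T"
      using C(2) \<omega>(1) by (metis Diff_iff singletonI subsetD)
  next
    assume "\<exists>\<omega>\<in>\<Omega>. \<not> spanned T \<omega> \<subseteq> T"
    then obtain \<omega> x where \<omega>: "\<omega> \<in> \<Omega>" "x \<in> spanned T \<omega>" "x \<notin> T"
      by blast
    obtain C where C: "circuit U \<Omega> r C" "x \<in> C" "min_elem \<Omega> R C = x" "C - {x} \<subseteq> above T \<omega>"
      using spanned_imp_circuit[OF T \<omega>(1,2)] by blast
    then have "C - T = {x}"
      using above_subset[of T \<omega>] \<omega>(3) by blast
    then show "\<exists>C. circuit U \<Omega> r C \<and> C - T = {min_elem \<Omega> R C}"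
      using C(1,3) by blast
  qed
  then show ?thesis
    unfolding cocompatible_def by fast
qed

section \<open>Nullity as a count of spanned choices\<close>

lemma rank_plus_card_spanned:
  assumes T: "transversal U \<Omega> T" and F: "F \<subseteq> \<Omega>"
    and up: "\<And>\<omega> \<omega>'. \<omega> \<in> F \<Longrightarrow> \<omega>' \<in> \<Omega> \<Longrightarrow> (\<omega>, \<omega>') \<in> R \<Longrightarrow> \<omega>' \<in> F"
  shows "r (T \<inter> \<Union>F) + card {\<omega> \<in> F. elem_at T \<omega> \<in> spanned T \<omega>} = card F"
  using F up
\<comment> \<open>\<open>F\<close> is a final segment of the order. Removing its least class
  \<open>m\<close> leaves a final segment, and restoring \<open>m\<close> adds one to the rank or
  one to the count of spanned choices.\<close>
proof (induction "card F" arbitrary: F)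
  case 0
  then have "F = {}"
    using finite_subset[OF _ finite_classes, of F] by simp
  then show ?case
    by (simp add: rank_empty)
next
  case (Suc n)
  have finF: "finite F"
    using finite_subset[OF Suc.prems(1) finite_classes] .
  obtain m where m: "m \<in> F" "\<And>\<omega>. \<omega> \<in> F - {m} \<Longrightarrow> (m, \<omega>) \<in> R"
    using least_class[of F] Suc.prems(1) Suc.hyps(2) card.empty by (metis nat.distinct(1))
  define G where "G = F - {m}"
  have m\<Omega>: "m \<in> \<Omega>"
    using m(1) Suc.prems(1) by blast
  have F: "F = insert m G" "m \<notin> G" and finG: "finite G"
    using m(1) finF by (auto simp: G_def)
  have "n = card G"
    using Suc.hyps(2) F finG by simp
  moreover have "\<omega>' \<in> G" if "\<omega> \<in> G" "\<omega>' \<in> \<Omega>" "(\<omega>, \<omega>') \<in> R" for \<omega> \<omega>'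
    using that Suc.prems(2)[of \<omega> \<omega>'] m(2)[of \<omega>] R_trans R_irrefl unfolding G_def by blast
  ultimately have IH: "r (T \<inter> \<Union>G) + card {\<omega> \<in> G. elem_at T \<omega> \<in> spanned T \<omega>} = card G"
    using Suc.hyps(1)[of G] Suc.prems(1) F by blast
  \<comment> \<open>The classes after \<open>m\<close> are exactly those of \<open>G\<close>,
    because \<open>m\<close> is least in \<open>F\<close> and \<open>F\<close> is closed
    upwards.\<close>
  have ab: "above T m = T \<inter> \<Union>G"
    using Suc.prems m R_irrefl unfolding above_def G_def by blast
  have TF: "T \<inter> \<Union>F = insert (elem_at T m) (above T m)"
    using transversal_elem_at[OF T m\<Omega>] unfolding ab F by blast
  have el: "elem_at T m \<in> m"
    using transversal_elem_at[OF T m\<Omega>] by blast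
  have sub: "subtransversal U \<Omega> (insert (elem_at T m) (above T m))"
    using subtransversal_insert[OF subtransversal_above[OF T] m\<Omega> el above_disjoint[OF m\<Omega>]] .
  show ?case
  proof (cases "elem_at T m \<in> spanned T m")
    case True
    then have "{\<omega> \<in> F. elem_at T \<omega> \<in> spanned T \<omega>} = insert m {\<omega> \<in> G. elem_at T \<omega> \<in> spanned T \<omega>}"
      unfolding F by blast
    moreover have "r (T \<inter> \<Union>F) = r (T \<inter> \<Union>G)"
      using True unfolding TF ab[symmetric] by (simp add: spanned_def)
    ultimately show ?thesis
      using IH F finG by simp
  next
    case False
    then have "{\<omega> \<in> F. elem_at T \<omega> \<in> spanned T \<omega>} = {\<omega> \<in> G. elem_at T \<omega> \<in> spanned T \<omega>}"
      unfolding F by blast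
    moreover have "r (T \<inter> \<Union>F) = Suc (r (T \<inter> \<Union>G))"
      using False el rank_insert_le[OF sub] rank_mono[OF sub subset_insertI]
      unfolding TF ab[symmetric] by (simp add: spanned_def)
    ultimately show ?thesis
      using IH F finG by simp
  qed
qed

lemma elem_at_eqI: "T \<inter> \<omega> = {x} \<Longrightarrow> elem_at T \<omega> = x"
  by (simp add: elem_at_def)

lemma inj_on_elem_at:
  assumes "transversal U \<Omega> T"
  shows "inj_on (elem_at T) \<Omega>"
proof (rule inj_onI)
  fix \<omega> \<omega>' assume \<omega>: "\<omega> \<in> \<Omega>" "\<omega>' \<in> \<Omega>" "elem_at T \<omega> = elem_at T \<omega>'"
  then show "\<omega> = \<omega>'"
    using transversal_elem_at[OF assms] class_unique[of \<omega> \<omega>' "elem_at T \<omega>"] by blast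
qed

lemma image_elem_at:
  assumes "transversal U \<Omega> T"
  shows "elem_at T ` \<Omega> = T"
proof -
  have "T = (\<Union>\<omega>\<in>\<Omega>. T \<inter> \<omega>)"
    using assms Union_classes by (auto simp: transversal_def)
  also have "\<dots> = elem_at T ` \<Omega>"
    using transversal_elem_at[OF assms] by auto
  finally show ?thesis
    by simp
qed

lemma nullity_eq_card_spanned:
  assumes T: "transversal U \<Omega> T"
  shows "nullity r T = card {\<omega> \<in> \<Omega>. elem_at T \<omega> \<in> spanned T \<omega>}"
proof -
  have "T \<inter> \<Union>\<Omega> = T"
    using T Union_classes by (auto simp: transversal_def)
  then have "r T + card {\<omega> \<in> \<Omega>. elem_at T \<omega> \<in> spanned T \<omega>} = card \<Omega>"
    using rank_plus_card_spanned[OF T subset_refl] by simp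
  moreover have "card T = card \<Omega>"
    using card_image[OF inj_on_elem_at[OF T]] image_elem_at[OF T] by simp
  ultimately show ?thesis
    by (simp add: nullity_def)
qed

section \<open>Normalisation onto cocompatible transversals\<close>

definition normalise :: "'a set \<Rightarrow> 'a set" where
  "normalise T = (\<Union>\<omega>\<in>\<Omega>. if spanned T \<omega> = {} then T \<inter> \<omega> else spanned T \<omega>)"

lemma spanned_subset: "spanned T \<omega> \<subseteq> \<omega>"
  by (auto simp: spanned_def)

lemma normalise_Int:
  assumes "\<omega> \<in> \<Omega>"
  shows "normalise T \<inter> \<omega> = (if spanned T \<omega> = {} then T \<inter> \<omega> else spanned T \<omega>)"
proof -
  define f where "f \<omega> = (if spanned T \<omega> = {} then T \<inter> \<omega> else spanned T \<omega>)" for \<omega>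
  have sub: "f \<omega>' \<subseteq> \<omega>'" for \<omega>'
    using spanned_subset by (auto simp: f_def)
  have "f \<omega>' \<inter> \<omega> = (if \<omega>' = \<omega> then f \<omega> else {})" if "\<omega>' \<in> \<Omega>" for \<omega>'
    using sub class_unique[OF that assms] by auto
  then have "(\<Union>\<omega>'\<in>\<Omega>. f \<omega>' \<inter> \<omega>) = (\<Union>\<omega>'\<in>\<Omega>. if \<omega>' = \<omega> then f \<omega> else {})"
    by (rule SUP_cong[OF refl])
  also have "\<dots> = f \<omega>"
    using assms by auto
  finally have "(\<Union>\<omega>'\<in>\<Omega>. f \<omega>') \<inter> \<omega> = f \<omega>"
    by simp
  then show ?thesis
    by (simp add: normalise_def f_def)
qed

lemma transversal_normalise:
  assumes T: "transversal U \<Omega> T"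
  shows "transversal U \<Omega> (normalise T)"
  unfolding transversal_iff
proof (intro conjI ballI)
  show "normalise T \<subseteq> U"
  proof -
    have "(if spanned T \<omega> = {} then T \<inter> \<omega> else spanned T \<omega>) \<subseteq> U" if "\<omega> \<in> \<Omega>" for \<omega>
      using spanned_subset[of T \<omega>] class_subset[OF that] by auto
    then show ?thesis
      unfolding normalise_def by blast
  qed
  fix \<omega> assume \<omega>: "\<omega> \<in> \<Omega>"
  have "\<exists>x. spanned T \<omega> = {x}" if "spanned T \<omega> \<noteq> {}"
    using that spanned_unique[OF T \<omega>] by blast
  then show "\<exists>x. normalise T \<inter> \<omega> = {x}"
    using transversal_elem_at[OF T \<omega>] by (simp add: normalise_Int[OF \<omega>])
qed

text \<open>Normalising alters \<open>T\<close> only in classes with a spanned element, where the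
  choice does not affect what is spanned.\<close>

lemma spanned_normalise:
  assumes "transversal U \<Omega> T" "\<omega> \<in> \<Omega>"
  shows "spanned (normalise T) \<omega> = spanned T \<omega>"
  using spanned_cong[OF assms(1) transversal_normalise[OF assms(1)] _ assms(2)]
  by (simp add: normalise_Int)

lemma normalise_in_Comp:
  assumes T: "transversal U \<Omega> T"
  shows "normalise T \<in> Comp U \<Omega> r R"
proof -
  have "spanned (normalise T) \<omega> \<subseteq> normalise T" if \<omega>: "\<omega> \<in> \<Omega>" for \<omega>
    using normalise_Int[OF \<omega>, of T] unfolding spanned_normalise[OF T \<omega>] by (metis Int_lower1 empty_subsetI)
  then show ?thesis
    using transversal_normalise[OF T] by (simp add: Comp_def cocompatible_iff)
qed

lemma Comp_spanned:
  assumes "S \<in> Comp U \<Omega> r R" "\<omega> \<in> \<Omega>" "spanned S \<omega> \<noteq> {}"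
  shows "spanned S \<omega> = S \<inter> \<omega>"
proof -
  have "transversal U \<Omega> S" "spanned S \<omega> \<subseteq> S \<inter> \<omega>"
    using assms(1,2) spanned_subset by (auto simp: Comp_def cocompatible_iff)
  then show ?thesis
    using transversal_elem_at[of S \<omega>] assms(2,3) subset_singletonD by metis
qed

text \<open>Describes the fibre over \<open>S\<close> by data of \<open>S\<close> alone. Agreement
  on the inactive classes makes all spanned sets of \<open>S\<close> and \<open>T\<close> equal, and
  in an active class the spanned element is the choice of the cocompatible \<open>S\<close>.\<close>

lemma normalise_eq_iff:
  assumes S: "S \<in> Comp U \<Omega> r R" and T: "transversal U \<Omega> T"
  shows "normalise T = S \<longleftrightarrow> (\<forall>\<omega>\<in>\<Omega>. spanned S \<omega> = {} \<longrightarrow> T \<inter> \<omega> = S \<inter> \<omega>)"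
proof
  assume "normalise T = S"
  then show "\<forall>\<omega>\<in>\<Omega>. spanned S \<omega> = {} \<longrightarrow> T \<inter> \<omega> = S \<inter> \<omega>"
    using normalise_Int[of _ T] spanned_normalise[OF T] by metis
next
  assume agree: "\<forall>\<omega>\<in>\<Omega>. spanned S \<omega> = {} \<longrightarrow> T \<inter> \<omega> = S \<inter> \<omega>"
  have trS: "transversal U \<Omega> S"
    using S by (simp add: Comp_def cocompatible_def)
  have eq: "spanned S \<omega> = spanned T \<omega>" if "\<omega> \<in> \<Omega>" for \<omega>
    using spanned_cong[OF trS T _ that] agree by simp
  show "normalise T = S"
  proof (rule transversal_eqI[OF transversal_normalise[OF T] trS])
    fix \<omega> assume \<omega>: "\<omega> \<in> \<Omega>"
    show "normalise T \<inter> \<omega> = S \<inter> \<omega>"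
      using agree \<omega> Comp_spanned[OF S \<omega>] by (simp add: normalise_Int eq[symmetric])
  qed
qed

section \<open>Weights and summation over a fibre\<close>

definition weight :: "'a set \<Rightarrow> 'a set \<Rightarrow> 'a \<Rightarrow> 'a mpoly" where
  "weight S \<omega> e = (if e \<in> spanned S \<omega> then var_t else 1) * var_x e"

text \<open>The nullity counts the classes whose chosen element is spanned, so the power of
  \<open>var_t\<close> splits into one factor per such class.\<close>

lemma transversal_weight:
  assumes T: "transversal U \<Omega> T"
  shows "var_t ^ nullity r T * (\<Prod>u\<in>T. var_x u) = (\<Prod>\<omega>\<in>\<Omega>. weight T \<omega> (elem_at T \<omega>))"
proof -
  have "(\<Prod>u\<in>T. var_x u) = (\<Prod>\<omega>\<in>\<Omega>. var_x (elem_at T \<omega>) :: 'a mpoly)"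
    using prod.reindex[OF inj_on_elem_at[OF T], of var_x] by (simp add: image_elem_at[OF T])
  moreover have "(\<Prod>\<omega>\<in>\<Omega>. if elem_at T \<omega> \<in> spanned T \<omega> then var_t else 1)
      = (var_t ^ nullity r T :: 'a mpoly)"
    by (simp add: nullity_eq_card_spanned[OF T] prod.If_cases[OF finite_classes] Collect_conj_eq Int_commute
        flip: Collect_mem_eq)
  ultimately show ?thesis
    by (simp add: weight_def prod.distrib)
qed

lemma fibre_sum:
  assumes S: "S \<in> Comp U \<Omega> r R"
  shows "(\<Sum>T | transversal U \<Omega> T \<and> normalise T = S. var_t ^ nullity r T * (\<Prod>u\<in>T. var_x u)) =
    (\<Prod>\<omega> \<in> inact U \<Omega> r R S. var_x (elem_at S \<omega>)) *
    (\<Prod>\<omega> \<in> act U \<Omega> r R S. (\<Sum>e \<in> \<omega> - {elem_at S \<omega>}. var_x e) + var_t * var_x (elem_at S \<omega>))"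
proof -
  have trS: "transversal U \<Omega> S"
    using S by (simp add: Comp_def cocompatible_def)
  \<comment> \<open>\<open>B \<omega>\<close> holds the admissible choices in \<omega> for a member
    of the fibre: the element of \<open>S\<close> in an inactive class, anything in an active
    one.\<close>
  define B where "B \<omega> = (if spanned S \<omega> = {} then S \<inter> \<omega> else \<omega>)" for \<omega>
  have B_subset: "B \<omega> \<subseteq> \<omega>" for \<omega>
    by (simp add: B_def)
  have finB: "finite (B \<omega>)" if "\<omega> \<in> \<Omega>" for \<omega>
    using finite_subset[OF B_subset finite_class[OF that]] .
  have img: "f ` \<Omega> \<inter> \<omega> = {f \<omega>}" if f: "f \<in> PiE \<Omega> B" and \<omega>: "\<omega> \<in> \<Omega>" for f \<omega>
  proof -
    have "f \<omega>' \<in> \<omega>'" if "\<omega>' \<in> \<Omega>" for \<omega>'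
      using PiE_mem[OF f that] B_subset by blast
    then show ?thesis
      using class_unique[OF _ \<omega>] \<omega> by blast
  qed
  have img_transversal: "transversal U \<Omega> (f ` \<Omega>)" if f: "f \<in> PiE \<Omega> B" for f
    unfolding transversal_iff using img[OF f] PiE_mem[OF f] B_subset class_subset by blast
  have "(\<Sum>T | transversal U \<Omega> T \<and> normalise T = S. var_t ^ nullity r T * (\<Prod>u\<in>T. var_x u))
      = (\<Sum>f\<in>PiE \<Omega> B. \<Prod>\<omega>\<in>\<Omega>. weight S \<omega> (f \<omega>))"
  \<comment> \<open>Members of the fibre correspond to choice functions for \<open>B\<close>, with
    the image as inverse; \<open>restrict\<close> supplies the extensionality that
    \<open>PiE\<close> demands.\<close>
  proof (rule sum.reindex_bij_witness[where i = "\<lambda>f. f ` \<Omega>" and j = "\<lambda>T. restrict (elem_at T) \<Omega>"])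
    fix T assume "T \<in> {T. transversal U \<Omega> T \<and> normalise T = S}"
    then have T: "transversal U \<Omega> T" and nT: "normalise T = S"
      by auto
    show "restrict (elem_at T) \<Omega> ` \<Omega> = T"
      using image_elem_at[OF T] by simp
    have "elem_at T \<omega> \<in> B \<omega>" if \<omega>: "\<omega> \<in> \<Omega>" for \<omega>
      using transversal_elem_at[OF T \<omega>] \<omega> nT normalise_eq_iff[OF S T] unfolding B_def by auto
    then show "restrict (elem_at T) \<Omega> \<in> PiE \<Omega> B"
      by auto
    \<comment> \<open>Spanned sets are constant on the fibre, so weights can be taken relative to
      \<open>S\<close> and each factor depends on a single choice.\<close>
    have "spanned S \<omega> = spanned T \<omega>" if "\<omega> \<in> \<Omega>" for \<omega>
      using spanned_normalise[OF T that] nT by simp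
    then show "(\<Prod>\<omega>\<in>\<Omega>. weight S \<omega> (restrict (elem_at T) \<Omega> \<omega>))
        = var_t ^ nullity r T * (\<Prod>u\<in>T. var_x u)"
      by (simp add: transversal_weight[OF T] weight_def)
  next
    fix f assume f: "f \<in> PiE \<Omega> B"
    show "restrict (elem_at (f ` \<Omega>)) \<Omega> = f"
    proof (rule PiE_ext[OF _ f])
      show "restrict (elem_at (f ` \<Omega>)) \<Omega> \<in> PiE \<Omega> B"
        using elem_at_eqI[OF img[OF f]] PiE_mem[OF f] by auto
    qed (simp add: elem_at_eqI[OF img[OF f]])
    have "f ` \<Omega> \<inter> \<omega> = S \<inter> \<omega>" if \<omega>: "\<omega> \<in> \<Omega>" "spanned S \<omega> = {}" for \<omega>
      using PiE_mem[OF f \<omega>(1)] \<omega>(2) transversal_elem_at[OF trS \<omega>(1)] by (simp add: img[OF f \<omega>(1)] B_def)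
    then show "f ` \<Omega> \<in> {T. transversal U \<Omega> T \<and> normalise T = S}"
      using img_transversal[OF f] normalise_eq_iff[OF S] by simp
  qed
  \<comment> \<open>Choices in different classes are independent, so distributivity turns the sum of
    products into a product of sums.\<close>
  also have "\<dots> = (\<Prod>\<omega>\<in>\<Omega>. \<Sum>e\<in>B \<omega>. weight S \<omega> e)"
    by (rule prod_sum_PiE[symmetric]) (simp_all add: finite_classes finB)
  also have "\<dots> = (\<Prod>\<omega>\<in>\<Omega>. if active U \<Omega> r R S \<omega>
      then (\<Sum>e \<in> \<omega> - {elem_at S \<omega>}. var_x e) + var_t * var_x (elem_at S \<omega>)
      else var_x (elem_at S \<omega>))"
  proof (rule prod.cong[OF refl])
    fix \<omega> assume \<omega>: "\<omega> \<in> \<Omega>"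
    note el = transversal_elem_at[OF trS \<omega>]
    show "(\<Sum>e\<in>B \<omega>. weight S \<omega> e) = (if active U \<Omega> r R S \<omega>
      then (\<Sum>e \<in> \<omega> - {elem_at S \<omega>}. var_x e) + var_t * var_x (elem_at S \<omega>)
      else var_x (elem_at S \<omega>))"
    proof (cases "spanned S \<omega> = {}")
      case True
      then show ?thesis
        by (simp add: active_iff[OF trS \<omega>] B_def weight_def el)
    next
      case False
      \<comment> \<open>By cocompatibility the unique spanned element is the one that
        \<open>S\<close> chooses, so it alone receives the factor \<open>var_t\<close>.\<close>
      then have sp: "spanned S \<omega> = {elem_at S \<omega>}"
        using Comp_spanned[OF S \<omega>] el by simp
      have "elem_at S \<omega> \<in> \<omega>"
        using el by blast
      then have "(\<Sum>e\<in>\<omega>. weight S \<omega> e)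
          = weight S \<omega> (elem_at S \<omega>) + (\<Sum>e \<in> \<omega> - {elem_at S \<omega>}. weight S \<omega> e)"
        using sum.remove[OF finite_class[OF \<omega>]] by blast
      also have "(\<Sum>e \<in> \<omega> - {elem_at S \<omega>}. weight S \<omega> e) = (\<Sum>e \<in> \<omega> - {elem_at S \<omega>}. var_x e)"
        by (rule sum.cong) (auto simp: weight_def sp)
      finally show ?thesis
        using False by (simp add: active_iff[OF trS \<omega>] B_def weight_def sp add.commute)
    qed
  qed
  also have "\<dots> = (\<Prod>\<omega> \<in> inact U \<Omega> r R S. var_x (elem_at S \<omega>)) *
    (\<Prod>\<omega> \<in> act U \<Omega> r R S. (\<Sum>e \<in> \<omega> - {elem_at S \<omega>}. var_x e) + var_t * var_x (elem_at S \<omega>))"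
  proof -
    have "\<Omega> \<inter> {\<omega>. active U \<Omega> r R S \<omega>} = act U \<Omega> r R S"
      "\<Omega> \<inter> - {\<omega>. active U \<Omega> r R S \<omega>} = inact U \<Omega> r R S"
      by (auto simp: act_def inact_def)
    then show ?thesis
      by (simp add: prod.If_cases[OF finite_classes] mult.commute)
  qed
  finally show ?thesis .
qed

lemma finite_Comp: "finite (Comp U \<Omega> r R)"
  by (rule finite_subset[OF _ finite_transversals]) (auto simp: Comp_def cocompatible_def)

end

theorem theorem4p11:
  fixes U :: "'a set" and \<Omega> :: "'a set set" and r :: "'a set \<Rightarrow> nat" and R :: "'a set rel"
  assumes "multimatroid U \<Omega> r"
    and "strict_linear_order_on \<Omega> R"
  shows "Q U \<Omega> r =
    (\<Sum>T \<in> Comp U \<Omega> r R.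
       (\<Prod>\<omega> \<in> inact U \<Omega> r R T. var_x (elem_at T \<omega>)) *
       (\<Prod>\<omega> \<in> act U \<Omega> r R T. (\<Sum>e \<in> \<omega> - {elem_at T \<omega>}. var_x e) + var_t * var_x (elem_at T \<omega>)))"
proof -
  interpret ordered_multimatroid U \<Omega> r R
    using assms by unfold_locales
  have "normalise ` {T. transversal U \<Omega> T} \<subseteq> Comp U \<Omega> r R"
    using normalise_in_Comp by blast
  \<comment> \<open>The sum over all transversals is split into the fibres of
    \<open>normalise\<close>, each evaluated by \<open>fibre_sum\<close>.\<close>
  from sum.group[OF finite_transversals finite_Comp this,
      of "\<lambda>T. var_t ^ nullity r T * (\<Prod>u\<in>T. var_x u) :: 'a mpoly"]
  show ?thesis
    by (simp add: Q_def fibre_sum cong: sum.cong)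
qed

end
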